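(* Let $n,m\ge 1$ be integers and let $Q := \{(\mathbf{x},\mathbf{y})\in\mathbb{R}^n\times\mathbb{R}^m : \|\mathbf{x}\|\le\|\mathbf{y}\|\}$. Let $\Gamma : D^m\to D^n$ be a function and define $$C_\Gamma := \{(\mathbf{x},\mathbf{y}) \in \mathbb{R}^n \times \mathbb{R}^m : \Gamma(\boldsymbol{\beta})^\top \mathbf{x} - \boldsymbol{\beta}^\top \mathbf{y} \ge 0 \ \text{ for all } \boldsymbol{\beta} \in D^m\}.$$ The set $C_\Gamma$ is a full-dimensional maximal $Q$-free set if and only if $\Gamma$ is non-expansive and $(\mathbf{0},\mathbf{0})\notin \operatorname{conv}(\{(\Gamma(\boldsymbol{\beta}),-\boldsymbol{\beta}) : \boldsymbol{\beta}\in D^m\})$.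
   Context: $\|\cdot\|$ is the Euclidean norm, $D^k := \{\mathbf{x}\in\mathbb{R}^k : \|\mathbf{x}\|=1\}$, and $\operatorname{conv}$ denotes the convex hull. A function $\Gamma: D^m\to D^n$ is non-expansive if $\|\Gamma(\boldsymbol{\beta})-\Gamma(\boldsymbol{\beta}')\|\le\|\boldsymbol{\beta}-\boldsymbol{\beta}'\|$ for every pair of distinct points $\boldsymbol{\beta},\boldsymbol{\beta}'\in D^m$. Given a closed set $S\subseteq\mathbb{R}^d$, a closed convex set $C\subseteq\mathbb{R}^d$ is $S$-free if its interior contains no point of $S$; it is a maximal $S$-free set if it is $S$-free and is not strictly contained in another ($S$-free, closed convex) set. $Q$-free means $S$-free with $S=Q$ in $\mathbb{R}^n\times\mathbb{R}^m$. A convex set is full-dimensional if it has nonempty interior. No continuity of $\Gamma$ is assumed. *)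

theory Defs
  imports "HOL-Analysis.Analysis"
begin

definition S_free :: "'a::euclidean_space set \<Rightarrow> 'a set \<Rightarrow> bool" where
  "S_free S C \<longleftrightarrow> closed C \<and> convex C \<and> interior C \<inter> S = {}"

definition maximal_S_free :: "'a::euclidean_space set \<Rightarrow> 'a set \<Rightarrow> bool" where
  "maximal_S_free S C \<longleftrightarrow> S_free S C \<and> \<not> (\<exists>K. S_free S K \<and> C \<subset> K)"

definition full_dimensional :: "'a::euclidean_space set \<Rightarrow> bool" where
  "full_dimensional C \<longleftrightarrow> interior C \<noteq> {}"

definition Q :: "((real ^ 'n) \<times> (real ^ 'm)) set" where
  "Q = {(x, y). norm x \<le> norm y}"

text \<open>
  The unit sphere of \<open>real ^ 'm\<close> is \<open>sphere 0 1\<close>. A map between unit spheres is represented by a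
  total function; the notions below depend only on its values on \<open>sphere 0 1\<close>.
\<close>

definition nonexpansive :: "(real ^ 'm \<Rightarrow> real ^ 'n) \<Rightarrow> bool" where
  "nonexpansive \<Gamma> \<longleftrightarrow>
     (\<forall>\<beta>\<in>sphere 0 1. \<forall>\<beta>'\<in>sphere 0 1. \<beta> \<noteq> \<beta>' \<longrightarrow> norm (\<Gamma> \<beta> - \<Gamma> \<beta>') \<le> norm (\<beta> - \<beta>'))"

definition C_set :: "(real ^ 'm \<Rightarrow> real ^ 'n) \<Rightarrow> ((real ^ 'n) \<times> (real ^ 'm)) set" where
  "C_set \<Gamma> = {(x, y). \<forall>\<beta>\<in>sphere 0 1. \<Gamma> \<beta> \<bullet> x - \<beta> \<bullet> y \<ge> 0}"

end

theory Submission
  imports Defs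
begin

text \<open>
  Write \<open>u \<beta> = (\<Gamma> \<beta>, - \<beta>)\<close> and \<open>p \<beta> = (\<Gamma> \<beta>, \<beta>)\<close>, so \<open>C_set \<Gamma>\<close> is the dual cone of the range of
  \<open>u\<close>, and \<open>\<Gamma>\<close> is non-expansive iff every \<open>p \<beta>\<close> lies in \<open>C_set \<Gamma>\<close>. If so, a closed convex
  \<open>K\<close> containing \<open>C_set \<Gamma>\<close> and a point \<open>q\<close> with \<open>u \<beta> \<bullet> q < 0\<close> contains \<open>q + \<epsilon> c + t p \<beta>\<close> in its
  interior (\<open>c\<close> interior to \<open>C_set \<Gamma>\<close>), and this point is in \<open>Q\<close> for large \<open>t\<close>.

  Conversely, say that a nonzero \<open>v = (a, -b)\<close> in the dual cone of \<open>C_set \<Gamma>\<close> serves \<open>\<beta>\<close> if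
  \<open>norm a \<le> b \<bullet> \<beta>\<close>: the half-space of \<open>v\<close> then keeps the ray of \<open>Q\<close> above \<open>\<beta>\<close> out of the interior.
  By maximality, for each \<open>z\<close> outside \<open>C_set \<Gamma>\<close> there is a \<open>\<beta>\<close> all of whose servers are negative
  at \<open>z\<close>. If \<open>u \<beta>\<^sub>1 \<bullet> p \<beta>\<^sub>0 < 0\<close>, then \<open>p \<beta>\<^sub>1\<close> is outside the cone; let \<open>z\<close> move from \<open>p \<beta>\<^sub>1\<close> in an
  interior direction up to the boundary point \<open>z\<^sup>*\<close>. At a limit \<open>\<beta>\<^sup>*\<close> of the bad \<open>\<beta>\<close> one finds a
  server of \<open>\<beta>\<^sup>*\<close>, robust under small changes of \<open>\<beta>\<close> and \<open>z\<close>, that is positive at \<open>z\<^sup>*\<close>.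
\<close>

definition serves :: "(real ^ 'n) \<times> (real ^ 'm) \<Rightarrow> real ^ 'm \<Rightarrow> bool" where
  "serves v \<beta> \<longleftrightarrow> v \<noteq> 0 \<and> norm (fst v) \<le> - snd v \<bullet> \<beta>"

section \<open>The closed convex cone \<open>C_set \<Gamma>\<close>\<close>

lemma C_set_iff: "z \<in> C_set \<Gamma> \<longleftrightarrow> (\<forall>\<beta>\<in>sphere 0 1. (\<Gamma> \<beta>, - \<beta>) \<bullet> z \<ge> 0)"
  by (cases z) (simp add: C_set_def inner_prod_def)

lemma C_set_Inter: "C_set \<Gamma> = (\<Inter>\<beta>\<in>sphere 0 1. {z. (\<Gamma> \<beta>, - \<beta>) \<bullet> z \<ge> 0})"
  by (auto simp: C_set_iff)

lemma closed_C_set: "closed (C_set \<Gamma>)"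
  unfolding C_set_Inter by (intro closed_INT ballI closed_halfspace_ge)

lemma convex_C_set: "convex (C_set \<Gamma>)"
  unfolding C_set_Inter by (intro convex_INT convex_halfspace_ge)

lemma C_set_add: "z \<in> C_set \<Gamma> \<Longrightarrow> w \<in> C_set \<Gamma> \<Longrightarrow> z + w \<in> C_set \<Gamma>"
  by (simp add: C_set_iff inner_add_right del: inner_Pair)

lemma C_set_scale: "z \<in> C_set \<Gamma> \<Longrightarrow> t \<ge> 0 \<Longrightarrow> t *\<^sub>R z \<in> C_set \<Gamma>"
  by (simp add: C_set_iff del: inner_Pair)

lemma inner_pos_interior:
  fixes v :: "'a::euclidean_space"
  assumes "v \<noteq> 0" "\<And>z. z \<in> K \<Longrightarrow> v \<bullet> z \<ge> 0" "z \<in> interior K"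
  shows "v \<bullet> z > 0"
proof -
  have "interior K \<subseteq> interior {z. v \<bullet> z \<ge> 0}"
    using assms(2) by (intro interior_mono) auto
  then show ?thesis using assms(1,3) by auto
qed

lemma constraint_pos_interior:
  assumes "\<beta> \<in> sphere 0 1" "z \<in> interior (C_set \<Gamma>)"
  shows "(\<Gamma> \<beta>, - \<beta>) \<bullet> z > 0"
proof (rule inner_pos_interior[OF _ _ assms(2)])
  show "(\<Gamma> \<beta>, - \<beta>) \<noteq> 0" using assms(1) by (auto simp: zero_prod_def)
qed (use assms(1) in \<open>simp add: C_set_iff\<close>)

section \<open>Q-freeness from half-spaces\<close>

text \<open>At a point \<open>(x, norm y *\<^sub>R \<beta>)\<close> of \<open>Q\<close>,
  Cauchy-Schwarz makes every server of \<beta> nonpositive, whereas a server that is nonnegative on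
  \<open>K\<close> is positive on its interior.\<close>

lemma served_directions_imp_S_free:
  fixes K :: "((real ^ 'n) \<times> (real ^ 'm)) set"
  assumes "closed K" "convex K"
    and v: "\<And>\<beta>. \<beta> \<in> sphere 0 1 \<Longrightarrow> \<exists>v. serves v \<beta> \<and> (\<forall>z\<in>K. v \<bullet> z \<ge> 0)"
  shows "S_free Q K"
proof -
  have False if z: "z \<in> interior K" "z \<in> Q" for z
  proof -
    obtain x y where xy: "z = (x, y)" "norm x \<le> norm y" using z(2) by (auto simp: Q_def)
    obtain \<beta> where \<beta>: "\<beta> \<in> sphere 0 1" "y = norm y *\<^sub>R \<beta>"
    proof (cases "y = 0")
      case True
      obtain e :: "real ^ 'm" where "norm e = 1" using vector_choose_size[of 1] by auto
      with True show ?thesis by (intro that[of e]) auto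
    next
      case False
      then show ?thesis by (intro that[of "sgn y"]) (auto simp: sgn_div_norm)
    qed
    obtain w where w: "serves w \<beta>" "\<forall>z\<in>K. w \<bullet> z \<ge> 0" using v[OF \<beta>(1)] by auto
    have "w \<bullet> z > 0" using w z by (intro inner_pos_interior[of w K z]) (auto simp: serves_def)
    then have "fst w \<bullet> x + snd w \<bullet> y > 0" using xy by (simp add: inner_prod_def)
    moreover have "fst w \<bullet> x \<le> norm (fst w) * norm y"
      by (meson Cauchy_Schwarz_ineq2 abs_le_D1 mult_left_mono norm_ge_zero order_trans xy(2))
    moreover have "norm (fst w) * norm y \<le> (- snd w \<bullet> \<beta>) * norm y"
      using w(1) by (intro mult_right_mono) (auto simp: serves_def)
    moreover have "snd w \<bullet> y = (snd w \<bullet> \<beta>) * norm y"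
      by (subst \<beta>(2)) simp
    ultimately show False by simp
  qed
  with assms show ?thesis by (auto simp: S_free_def)
qed

lemma serves_constraint:
  assumes "\<Gamma> \<in> sphere 0 1 \<rightarrow> sphere 0 1" "\<beta> \<in> sphere 0 1"
  shows "serves (\<Gamma> \<beta>, - \<beta>) \<beta>"
proof -
  have "\<Gamma> \<beta> \<in> sphere 0 1" using assms by auto
  then show ?thesis using assms(2) by (auto simp: serves_def zero_prod_def dot_square_norm)
qed

lemma S_free_C_set:
  fixes \<Gamma> :: "real ^ 'm \<Rightarrow> real ^ 'n"
  assumes "\<Gamma> \<in> sphere 0 1 \<rightarrow> sphere 0 1"
  shows "S_free Q (C_set \<Gamma>)"
proof (intro served_directions_imp_S_free closed_C_set convex_C_set)
  fix \<beta> :: "real ^ 'm" assume \<beta>: "\<beta> \<in> sphere 0 1"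
  then have "\<forall>z\<in>C_set \<Gamma>. (\<Gamma> \<beta>, - \<beta>) \<bullet> z \<ge> 0" by (simp add: C_set_iff del: inner_Pair)
  with serves_constraint[OF assms \<beta>] show "\<exists>v. serves v \<beta> \<and> (\<forall>z\<in>C_set \<Gamma>. v \<bullet> z \<ge> 0)" by blast
qed

section \<open>Non-expansiveness as membership in the cone\<close>

lemma dist_unit_le_iff:
  assumes "norm a = 1" "norm b = 1" "norm c = 1" "norm d = 1"
  shows "norm (a - b) \<le> norm (c - d) \<longleftrightarrow> c \<bullet> d \<le> a \<bullet> b"
proof -
  have "norm (a - b) \<le> norm (c - d) \<longleftrightarrow> (norm (a - b))\<^sup>2 \<le> (norm (c - d))\<^sup>2"
    by (simp add: power_mono_iff)
  also have "\<dots> \<longleftrightarrow> c \<bullet> d \<le> a \<bullet> b"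
    using assms by (simp add: power2_norm_eq_inner inner_diff_left inner_diff_right inner_commute norm_eq_1)
  finally show ?thesis .
qed

text \<open>For unit vectors the distance inequality reverses into one between inner products, which
  is the constraint of one point evaluated at \<open>p\<close> of the other.\<close>

lemma nonexpansive_iff:
  assumes "\<Gamma> \<in> sphere 0 1 \<rightarrow> sphere 0 1"
  shows "nonexpansive \<Gamma> \<longleftrightarrow> (\<forall>\<beta>\<in>sphere 0 1. (\<Gamma> \<beta>, \<beta>) \<in> C_set \<Gamma>)"
proof -
  have n: "norm (\<Gamma> \<beta>) = 1" if "norm \<beta> = 1" for \<beta> using assms that by auto
  have "nonexpansive \<Gamma> \<longleftrightarrow>
      (\<forall>\<beta>\<in>sphere 0 1. \<forall>\<beta>'\<in>sphere 0 1. norm (\<Gamma> \<beta> - \<Gamma> \<beta>') \<le> norm (\<beta> - \<beta>'))"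
    unfolding nonexpansive_def by (metis diff_self norm_zero order_refl)
  also have "\<dots> \<longleftrightarrow> (\<forall>\<beta>\<in>sphere 0 1. \<forall>\<beta>'\<in>sphere 0 1. \<beta>' \<bullet> \<beta> \<le> \<Gamma> \<beta>' \<bullet> \<Gamma> \<beta>)"
    using n by (intro ball_cong refl) (simp add: dist_unit_le_iff inner_commute)
  also have "\<dots> \<longleftrightarrow> (\<forall>\<beta>\<in>sphere 0 1. (\<Gamma> \<beta>, \<beta>) \<in> C_set \<Gamma>)"
    by (simp add: C_set_def)
  finally show ?thesis .
qed

section \<open>Full dimension and the convex hull condition\<close>

text \<open>An interior point of the cone, read as a linear functional, is positive on all
  generators and hence on their hull.\<close>

lemma zero_notin_hull:
  assumes "full_dimensional (C_set \<Gamma>)"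
  shows "(0, 0) \<notin> convex hull {(\<Gamma> \<beta>, - \<beta>) | \<beta>. \<beta> \<in> sphere 0 1}"
proof -
  obtain c where c: "c \<in> interior (C_set \<Gamma>)" using assms by (auto simp: full_dimensional_def)
  have "convex hull {(\<Gamma> \<beta>, - \<beta>) | \<beta>. \<beta> \<in> sphere 0 1} \<subseteq> {v. c \<bullet> v > 0}"
    using constraint_pos_interior[OF _ c]
    by (intro hull_minimal convex_halfspace_gt) (auto simp: inner_commute[of c] simp del: inner_Pair)
  then show ?thesis by (auto simp: inner_prod_def)
qed

text \<open>Non-expansiveness gives continuity, so the hull is compact and can be strictly separated
  from the origin; the separating vector is an interior point.\<close>

lemma full_dimensional_C_set:
  fixes \<Gamma> :: "real ^ 'm \<Rightarrow> real ^ 'n"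
  assumes \<Gamma>: "\<Gamma> \<in> sphere 0 1 \<rightarrow> sphere 0 1" and "nonexpansive \<Gamma>"
    and 0: "(0, 0) \<notin> convex hull {(\<Gamma> \<beta>, - \<beta>) | \<beta>. \<beta> \<in> sphere 0 1}"
  shows "full_dimensional (C_set \<Gamma>)"
proof -
  let ?G = "{(\<Gamma> \<beta>, - \<beta>) | \<beta>. \<beta> \<in> sphere 0 1}"
  have "dist (\<Gamma> x) (\<Gamma> y) \<le> dist x y" if "x \<in> sphere 0 1" "y \<in> sphere 0 1" for x y
    using assms(2) that unfolding nonexpansive_def dist_norm
    by (metis diff_self norm_zero order_refl)
  then have "continuous_on (sphere 0 1) \<Gamma>"
    unfolding continuous_on_iff by (meson le_less_trans)
  then have "compact ((\<lambda>\<beta>. (\<Gamma> \<beta>, - \<beta>)) ` sphere 0 1)"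
    by (intro compact_continuous_image continuous_intros) auto
  moreover have "?G = (\<lambda>\<beta>. (\<Gamma> \<beta>, - \<beta>)) ` sphere 0 1" by auto
  ultimately have "closed (convex hull ?G)"
    by (simp add: compact_convex_hull compact_imp_closed)
  then obtain c b where c: "0 < b" "\<And>v. v \<in> convex hull ?G \<Longrightarrow> c \<bullet> v > b"
    using separating_hyperplane_closed_0[of "convex hull ?G"] 0 by (auto simp: zero_prod_def)
  \<comment> \<open>Generators have norm at most 2, so moving \<open>c\<close> by less than
    \<open>b / 2\<close> lowers each constraint by at most \<open>b\<close>.\<close>
  have "ball c (b / 2) \<subseteq> C_set \<Gamma>"
  proof
    fix z assume "z \<in> ball c (b / 2)"
    then have z: "norm (c - z) < b / 2" by (simp add: dist_norm)
    have "(\<Gamma> \<beta>, - \<beta>) \<bullet> z \<ge> 0" if \<beta>: "\<beta> \<in> sphere 0 1" for \<beta>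
    proof -
      let ?v = "(\<Gamma> \<beta>, - \<beta>)"
      have "\<Gamma> \<beta> \<in> sphere 0 1" using \<Gamma> \<beta> by auto
      then have "norm ?v \<le> 2" using norm_Pair_le[of "\<Gamma> \<beta>" "- \<beta>"] \<beta> by simp
      then have "norm ?v * norm (c - z) \<le> 2 * (b / 2)" using z by (intro mult_mono) auto
      then have "?v \<bullet> (c - z) \<le> b" using norm_cauchy_schwarz[of ?v "c - z"] by linarith
      moreover have "?v \<bullet> c > b"
        using c(2)[OF hull_inc, of ?v] \<beta> by (auto simp: inner_commute simp del: inner_Pair)
      ultimately show ?thesis by (simp only: inner_diff_right)
    qed
    then show "z \<in> C_set \<Gamma>" by (simp add: C_set_iff del: inner_Pair)
  qed
  then have "c \<in> interior (C_set \<Gamma>)" using c(1) half_gt_zero mem_interior by blast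
  then show ?thesis by (auto simp: full_dimensional_def)
qed

section \<open>Maximality for non-expansive maps\<close>

text \<open>The point is a limit of convex combinations of \<open>q\<close> with ever farther points
  of the ray, weighted by the inverse of their distance factor.\<close>

lemma closed_convex_add_cone:
  fixes K :: "'a::real_normed_vector set"
  assumes "closed K" "convex K" "q \<in> K" and cone: "\<And>t. t \<ge> 0 \<Longrightarrow> t *\<^sub>R w \<in> K"
  shows "q + w \<in> K"
proof -
  let ?f = "\<lambda>k. (1 - inverse (real (Suc k))) *\<^sub>R q + inverse (real (Suc k)) *\<^sub>R (real (Suc k) *\<^sub>R w)"
  have "?f k \<in> K" for k
  proof (rule convexD[OF assms(2,3) cone])
    show "0 \<le> 1 - inverse (real (Suc k))" by (simp add: inverse_le_1_iff)
  qed auto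
  moreover have "?f = (\<lambda>k. (1 - inverse (real (Suc k))) *\<^sub>R q + w)" by auto
  moreover have "(\<lambda>k. (1 - inverse (real (Suc k))) *\<^sub>R q + w) \<longlonglongrightarrow> (1 - 0) *\<^sub>R q + w"
    by (intro tendsto_intros LIMSEQ_inverse_real_of_nat)
  ultimately show ?thesis
    using closed_sequentially[OF assms(1), of ?f "q + w"] by auto
qed

lemma maximal_C_set:
  fixes \<Gamma> :: "real ^ 'm \<Rightarrow> real ^ 'n"
  assumes \<Gamma>: "\<Gamma> \<in> sphere 0 1 \<rightarrow> sphere 0 1" and "nonexpansive \<Gamma>" "full_dimensional (C_set \<Gamma>)"
  shows "maximal_S_free Q (C_set \<Gamma>)"
proof -
  obtain c where c: "c \<in> interior (C_set \<Gamma>)" using assms(3) by (auto simp: full_dimensional_def)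
  have False if K: "S_free Q K" "C_set \<Gamma> \<subset> K" for K
  proof -
    obtain q where q: "q \<in> K" "q \<notin> C_set \<Gamma>" using K by auto
    then obtain \<beta> where \<beta>: "\<beta> \<in> sphere 0 1" "(\<Gamma> \<beta>, - \<beta>) \<bullet> q < 0" by (auto simp: C_set_iff not_le)
    let ?u = "(\<Gamma> \<beta>, - \<beta>)" and ?p = "(\<Gamma> \<beta>, \<beta>)"
    have p: "?p \<in> C_set \<Gamma>" using assms(2) \<beta>(1) nonexpansive_iff[OF \<Gamma>] by blast
    have n: "norm (\<Gamma> \<beta>) = 1" "norm \<beta> = 1" using \<Gamma> \<beta>(1) by auto
    have uc: "?u \<bullet> c > 0" by (rule constraint_pos_interior[OF \<beta>(1) c])
    \<comment> \<open>Chosen so that moving into the interior direction \<open>c\<close> only halves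
      the violation at \<open>q\<close>.\<close>
    define \<epsilon> where "\<epsilon> = - (?u \<bullet> q) / (2 * (?u \<bullet> c))"
    have \<epsilon>: "\<epsilon> > 0" using uc \<beta>(2) by (simp only: \<epsilon>_def) (intro divide_pos_pos, auto)
    define r where "r = q + \<epsilon> *\<^sub>R c"
    have "?u \<bullet> r = (?u \<bullet> q) / 2"
      using uc by (simp only: r_def inner_add_right inner_scaleR_right \<epsilon>_def) (simp add: field_simps del: inner_Pair)
    with \<beta>(2) have ur: "?u \<bullet> r < 0" by linarith
    \<comment> \<open>Adding \<open>t *\<^sub>R ?p\<close> changes
      \<open>(norm (fst r))\<^sup>2 - (norm (snd r))\<^sup>2\<close> by
      \<open>2 * t * (?u \<bullet> r)\<close>, the quadratic terms cancelling; this \<open>t\<close>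
      makes the result nonpositive.\<close>
    define t where "t = max 0 (((norm (fst r))\<^sup>2 - (norm (snd r))\<^sup>2) / (- 2 * (?u \<bullet> r)))"
    have "t \<ge> ((norm (fst r))\<^sup>2 - (norm (snd r))\<^sup>2) / (- 2 * (?u \<bullet> r))" by (simp add: t_def)
    then have t: "t * (- 2 * (?u \<bullet> r)) \<ge> (norm (fst r))\<^sup>2 - (norm (snd r))\<^sup>2" "t \<ge> 0"
      using ur by (simp_all only: pos_divide_le_eq) (auto simp: t_def)
    let ?z = "r + t *\<^sub>R ?p"
    have "(norm (fst ?z))\<^sup>2 \<le> (norm (snd ?z))\<^sup>2"
      using t(1) n unfolding power2_norm_eq_inner norm_eq_1
      by (simp add: inner_prod_def inner_add_left inner_add_right inner_commute algebra_simps)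
    then have "norm (fst ?z) \<le> norm (snd ?z)" by (rule power2_le_imp_le) simp
    then have zQ: "?z \<in> Q" by (simp add: Q_def case_prod_beta)
    let ?T = "(\<lambda>w. (q + t *\<^sub>R ?p) + \<epsilon> *\<^sub>R w) ` interior (C_set \<Gamma>)"
    have "(q + t *\<^sub>R ?p) + \<epsilon> *\<^sub>R w \<in> K" if "w \<in> C_set \<Gamma>" for w
    proof -
      have "t *\<^sub>R ?p + \<epsilon> *\<^sub>R w \<in> C_set \<Gamma>"
        using that p t \<epsilon> by (intro C_set_add C_set_scale) auto
      then have "q + (t *\<^sub>R ?p + \<epsilon> *\<^sub>R w) \<in> K"
        using K q(1) C_set_scale by (intro closed_convex_add_cone) (unfold S_free_def, blast+)
      then show ?thesis by (simp add: add.assoc)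
    qed
    then have "?T \<subseteq> K" using interior_subset by blast
    moreover have "open ?T"
    proof -
      have "?T = (\<lambda>w. (q + t *\<^sub>R ?p) + w) ` ((\<lambda>w. \<epsilon> *\<^sub>R w) ` interior (C_set \<Gamma>))"
        by (simp add: image_image)
      then show ?thesis using \<epsilon> by (metis open_translation open_scaling open_interior less_irrefl)
    qed
    moreover have "?z \<in> ?T" using c by (intro image_eqI[of _ _ c]) (auto simp: r_def)
    ultimately have "?z \<in> interior K" by (rule interiorI[rotated 2])
    then show False using zQ K(1) by (auto simp: S_free_def)
  qed
  then show ?thesis using S_free_C_set[OF \<Gamma>] by (auto simp: maximal_S_free_def)
qed

section \<open>Non-expansiveness from maximality\<close>

text \<open>The intersection \<open>K\<close> of all half-spaces valid on \<open>C\<close> and at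
  \<open>z\<close> properly contains \<open>C\<close>, so it is not Q-free and some direction has no
  server valid on \<open>K\<close>.\<close>

lemma maximal_imp_bad_direction:
  assumes "maximal_S_free Q C" "z \<notin> C"
  obtains \<beta> where "\<beta> \<in> sphere 0 1"
    "\<And>v. serves v \<beta> \<Longrightarrow> (\<forall>w\<in>C. v \<bullet> w \<ge> 0) \<Longrightarrow> v \<bullet> z < 0"
proof -
  define K where "K = (\<Inter>v\<in>{v. (\<forall>w\<in>C. v \<bullet> w \<ge> 0) \<and> v \<bullet> z \<ge> 0}. {w. v \<bullet> w \<ge> 0})"
  have "C \<subseteq> K" "z \<in> K" by (auto simp: K_def)
  then have "\<not> S_free Q K" using assms by (auto simp: maximal_S_free_def)
  moreover have "closed K" "convex K"
    unfolding K_def by (intro closed_INT convex_INT ballI closed_halfspace_ge convex_halfspace_ge)+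
  ultimately obtain \<beta> where \<beta>: "\<beta> \<in> sphere 0 1"
      "\<And>v. serves v \<beta> \<Longrightarrow> \<not> (\<forall>w\<in>K. v \<bullet> w \<ge> 0)"
    using served_directions_imp_S_free[of K] by blast
  have "v \<bullet> z < 0" if "serves v \<beta>" "\<forall>w\<in>C. v \<bullet> w \<ge> 0" for v
  proof (rule ccontr)
    assume "\<not> v \<bullet> z < 0"
    then have "\<forall>w\<in>K. v \<bullet> w \<ge> 0" using that(2) unfolding K_def not_less by blast
    with \<beta>(2)[OF that(1)] show False ..
  qed
  with \<beta>(1) show ?thesis using that by blast
qed

text \<open>At \<open>(x, \<beta>)\<close> with \<open>norm x \<le> 1\<close>, the constraint of
  \<beta> forces \<open>x = \<Gamma> \<beta>\<close>. So the whole slice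
  \<open>cball 0 1 \<times> {\<beta>}\<close> misses the cone, and separating the two gives the
  strict inequality.\<close>

lemma strict_server:
  fixes \<Gamma> :: "real ^ 'm \<Rightarrow> real ^ 'n"
  assumes \<Gamma>: "\<Gamma> \<in> sphere 0 1 \<rightarrow> sphere 0 1" and \<beta>: "\<beta> \<in> sphere 0 1" "(\<Gamma> \<beta>, \<beta>) \<notin> C_set \<Gamma>"
  obtains v where "\<And>w. w \<in> C_set \<Gamma> \<Longrightarrow> v \<bullet> w \<ge> 0" "norm (fst v) < - snd v \<bullet> \<beta>"
proof -
  have n: "norm (\<Gamma> \<beta>) = 1" "norm \<beta> = 1" using \<Gamma> \<beta>(1) by auto
  have "(x, \<beta>) \<notin> C_set \<Gamma>" if "norm x \<le> 1" for x
  proof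
    assume "(x, \<beta>) \<in> C_set \<Gamma>"
    then have "\<Gamma> \<beta> \<bullet> x \<ge> \<beta> \<bullet> \<beta>" using \<beta>(1) by (simp add: C_set_def)
    then have x: "\<Gamma> \<beta> \<bullet> x \<ge> 1" using n by (simp add: dot_square_norm)
    have "(norm (x - \<Gamma> \<beta>))\<^sup>2 = (norm x)\<^sup>2 + 1 - 2 * (\<Gamma> \<beta> \<bullet> x)"
      using n by (simp add: power2_norm_eq_inner inner_diff_left inner_diff_right inner_commute norm_eq_1)
    moreover have "(norm x)\<^sup>2 \<le> 1" using that by (simp add: abs_square_le_1)
    ultimately have "(norm (x - \<Gamma> \<beta>))\<^sup>2 \<le> 0" using x by linarith
    then have "x = \<Gamma> \<beta>" by simp
    with \<open>(x, \<beta>) \<in> C_set \<Gamma>\<close> \<beta>(2) show False by simp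
  qed
  then have "(cball 0 1 \<times> {\<beta>}) \<inter> C_set \<Gamma> = {}" by auto
  moreover have "compact (cball 0 1 \<times> {\<beta>} :: ((real ^ 'n) \<times> (real ^ 'm)) set)"
    by (intro compact_Times) auto
  moreover have "cball 0 1 \<times> {\<beta>} \<noteq> ({} :: ((real ^ 'n) \<times> (real ^ 'm)) set)" by auto
  ultimately obtain v b where v: "\<forall>z\<in>cball 0 1 \<times> {\<beta>}. v \<bullet> z < b" "\<forall>z\<in>C_set \<Gamma>. v \<bullet> z > b"
    using separating_hyperplane_compact_closed[of "cball 0 1 \<times> {\<beta>}" "C_set \<Gamma>"]
      closed_C_set convex_C_set by (metis convex_Times convex_cball convex_singleton)
  have "0 \<in> C_set \<Gamma>" by (simp add: C_set_iff)
  then have b: "b < 0" using v(2) by force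
  have nonneg: "v \<bullet> w \<ge> 0" if w: "w \<in> C_set \<Gamma>" for w
  proof (rule ccontr)
    assume neg: "\<not> v \<bullet> w \<ge> 0"
    \<comment> \<open>This multiple of \<open>w\<close> has \<open>v\<close>-value exactly
      \<open>b\<close>, contradicting the separation.\<close>
    then have "(b / (v \<bullet> w)) *\<^sub>R w \<in> C_set \<Gamma>" using b w by (intro C_set_scale) (auto simp: divide_nonpos_neg)
    then have "b < (b / (v \<bullet> w)) * (v \<bullet> w)" using v(2) by (metis inner_scaleR_right)
    then show False using neg by simp
  qed
  \<comment> \<open>This point of the slice maximizes \<open>v\<close>.\<close>
  have "(sgn (fst v), \<beta>) \<in> cball 0 1 \<times> {\<beta>}" by (simp add: norm_sgn)
  then have "v \<bullet> (sgn (fst v), \<beta>) < 0" using v(1) b by force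
  moreover have "fst v \<bullet> sgn (fst v) = norm (fst v)"
    by (cases "fst v = 0") (simp_all add: sgn_div_norm dot_square_norm power2_eq_square)
  ultimately have "norm (fst v) < - snd v \<bullet> \<beta>" by (simp add: inner_prod_def)
  with nonneg show ?thesis using that by blast
qed

text \<open>The parameters that land in \<open>C\<close> form a closed up-set of positive reals, so
  \<open>t\<close> is their infimum. They exist because \<open>c + \<delta> *\<^sub>R q\<close> lies
  in \<open>C\<close> for small \<delta> and can be rescaled.\<close>

lemma boundary_point_on_ray:
  fixes C :: "'a::euclidean_space set"
  assumes "closed C" "q \<notin> C" "c \<in> interior C"
    and add: "\<And>z w. z \<in> C \<Longrightarrow> w \<in> C \<Longrightarrow> z + w \<in> C"
    and scale: "\<And>z t. z \<in> C \<Longrightarrow> t \<ge> 0 \<Longrightarrow> t *\<^sub>R z \<in> C"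
  obtains t where "t > 0" "q + t *\<^sub>R c \<in> C" "\<And>s. s < t \<Longrightarrow> q + s *\<^sub>R c \<notin> C"
proof -
  define S where "S = {s. q + s *\<^sub>R c \<in> C}"
  have c: "c \<in> C" using assms(3) interior_subset by blast
  have up: "s \<in> S \<Longrightarrow> s \<le> s' \<Longrightarrow> s' \<in> S" for s s'
    using add[of "q + s *\<^sub>R c" "(s' - s) *\<^sub>R c"] scale[OF c, of "s' - s"]
    by (simp add: S_def scaleR_diff_left)
  have pos: "s > 0" if "s \<in> S" for s
    using up[OF that, of 0] assms(2) by (force simp: S_def)
  have "S = (\<lambda>s. q + s *\<^sub>R c) -` C" by (auto simp: S_def)
  then have "closed S" using assms(1) by (auto intro!: closed_vimage continuous_intros)
  obtain e where e: "e > 0" "ball c e \<subseteq> C" using assms(3) by (auto simp: mem_interior)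
  define \<delta> where "\<delta> = e / (norm q + 1)"
  have \<delta>: "\<delta> > 0" using e(1) by (simp add: \<delta>_def add_nonneg_pos)
  have "norm (\<delta> *\<^sub>R q) < e"
    using e(1) by (simp add: \<delta>_def divide_simps add_nonneg_pos abs_of_pos)
  then have "c + \<delta> *\<^sub>R q \<in> C" using e(2) by (auto simp: dist_norm)
  then have "inverse \<delta> *\<^sub>R (c + \<delta> *\<^sub>R q) \<in> C" using \<delta> by (intro scale) auto
  then have "inverse \<delta> \<in> S" using \<delta> by (simp add: S_def scaleR_add_right add.commute)
  then have "S \<noteq> {}" by auto
  moreover have bdd: "bdd_below S" using pos by (meson bdd_belowI less_imp_le)
  ultimately have "Inf S \<in> S" using \<open>closed S\<close> by (intro closed_contains_Inf)
  moreover have "s \<notin> S" if "s < Inf S" for s using that bdd cInf_lower by (metis not_less)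
  ultimately show ?thesis using that[of "Inf S"] pos[of "Inf S"] unfolding S_def mem_Collect_eq by blast
qed

lemma maximal_imp_nonexpansive:
  fixes \<Gamma> :: "real ^ 'm \<Rightarrow> real ^ 'n"
  assumes \<Gamma>: "\<Gamma> \<in> sphere 0 1 \<rightarrow> sphere 0 1"
    and full: "full_dimensional (C_set \<Gamma>)" and max: "maximal_S_free Q (C_set \<Gamma>)"
  shows "nonexpansive \<Gamma>"
proof (rule ccontr)
  define u where "u \<beta> = (\<Gamma> \<beta>, - \<beta>)" for \<beta>
  define p where "p \<beta> = (\<Gamma> \<beta>, \<beta>)" for \<beta>
  have sym: "u \<beta> \<bullet> p \<gamma> = u \<gamma> \<bullet> p \<beta>" for \<beta> \<gamma>
    by (simp add: u_def p_def inner_commute)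
  have C: "z \<in> C_set \<Gamma> \<longleftrightarrow> (\<forall>\<beta>\<in>sphere 0 1. u \<beta> \<bullet> z \<ge> 0)" for z
    by (simp add: C_set_iff u_def)
  have n: "norm (\<Gamma> \<beta>) = 1" if "\<beta> \<in> sphere 0 1" for \<beta> using \<Gamma> that by auto
  assume "\<not> nonexpansive \<Gamma>"
  then obtain \<beta>0 where "\<beta>0 \<in> sphere 0 1" "p \<beta>0 \<notin> C_set \<Gamma>"
    unfolding p_def using nonexpansive_iff[OF \<Gamma>] by blast
  then obtain \<beta>1 where \<beta>1: "\<beta>0 \<in> sphere 0 1" "\<beta>1 \<in> sphere 0 1" "u \<beta>1 \<bullet> p \<beta>0 < 0"
    by (auto simp: C not_le)
  \<comment> \<open>By symmetry \<open>q\<close> violates the constraint of \<open>\<beta>0\<close>,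
    while its own constraint, that of \<open>\<beta>1\<close>, is tight.\<close>
  define q where "q = p \<beta>1"
  have qC: "q \<notin> C_set \<Gamma>" using \<beta>1 sym[of \<beta>0 \<beta>1] by (force simp: C q_def)
  obtain c where c: "c \<in> interior (C_set \<Gamma>)" using full by (auto simp: full_dimensional_def)
  have uc: "u \<beta> \<bullet> c > 0" if "\<beta> \<in> sphere 0 1" for \<beta>
    using constraint_pos_interior[OF that c] by (simp only: u_def)
  obtain t where t: "t > 0" "q + t *\<^sub>R c \<in> C_set \<Gamma>" "\<And>s. s < t \<Longrightarrow> q + s *\<^sub>R c \<notin> C_set \<Gamma>"
    using boundary_point_on_ray[OF closed_C_set qC c C_set_add C_set_scale] by blast
  define z where "z = q + t *\<^sub>R c"
  define Z where "Z k = q + (t - inverse (real (Suc k))) *\<^sub>R c" for k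
  have "Z \<longlonglongrightarrow> q + (t - 0) *\<^sub>R c"
    unfolding Z_def by (intro tendsto_intros LIMSEQ_inverse_real_of_nat)
  then have Z: "Z \<longlonglongrightarrow> z" by (simp add: z_def)
  have "Z k \<notin> C_set \<Gamma>" for k unfolding Z_def by (intro t(3)) simp
  then have "\<exists>\<beta>. \<beta> \<in> sphere 0 1 \<and> (\<forall>v. serves v \<beta> \<longrightarrow> (\<forall>w\<in>C_set \<Gamma>. v \<bullet> w \<ge> 0) \<longrightarrow> v \<bullet> Z k < 0)" for k
    using maximal_imp_bad_direction[OF max, of "Z k"] by metis
  then obtain B where B: "\<And>k. B k \<in> sphere 0 1"
      "\<And>k v. serves v (B k) \<Longrightarrow> \<forall>w\<in>C_set \<Gamma>. v \<bullet> w \<ge> 0 \<Longrightarrow> v \<bullet> Z k < 0" by metis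
  \<comment> \<open>As \<Gamma> may be discontinuous, its values along the bad directions are made
    to converge too; their limit \<open>g\<close> need not be
    \<open>\<Gamma> \<beta>\<close>.\<close>
  have "compact (sphere 0 1 \<times> sphere 0 1 :: ((real ^ 'n) \<times> (real ^ 'm)) set)"
    by (intro compact_Times compact_sphere)
  moreover have "p (B k) \<in> sphere 0 1 \<times> sphere 0 1" for k using B(1) \<Gamma> by (auto simp: p_def)
  ultimately obtain l r where l: "l \<in> sphere 0 1 \<times> sphere 0 1" "strict_mono r" "((\<lambda>k. p (B k)) \<circ> r) \<longlonglongrightarrow> l"
    unfolding compact_def by (metis (no_types, lifting))
  obtain g \<beta> where g: "l = (g, \<beta>)" "norm g = 1" "\<beta> \<in> sphere 0 1" using l(1) by (cases l) auto
  have lim\<Gamma>: "(\<lambda>k. \<Gamma> (B (r k))) \<longlonglongrightarrow> g" and limB: "(\<lambda>k. B (r k)) \<longlonglongrightarrow> \<beta>"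
    using tendsto_fst[OF l(3)] tendsto_snd[OF l(3)] by (simp_all add: g p_def o_def)
  have limu: "(\<lambda>k. u (B (r k))) \<longlonglongrightarrow> (g, - \<beta>)"
    unfolding u_def by (intro tendsto_intros lim\<Gamma> limB)
  have limZ: "(\<lambda>k. Z (r k)) \<longlonglongrightarrow> z"
    using LIMSEQ_subseq_LIMSEQ[OF Z l(2)] by (simp add: o_def)
  show False
  proof (cases "p \<beta> \<in> C_set \<Gamma>")
    case True
    \<comment> \<open>Here the constraints at \<open>p \<beta>\<close> pass to the limit and force
      \<open>g = \<Gamma> \<beta>\<close>, so the servers \<open>u (B (r k))\<close> tend to
      \<open>u \<beta>\<close>, which is positive at \<open>z\<close>.\<close>
    have "(g, - \<beta>) \<bullet> p \<beta> \<ge> 0"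
      using True B(1) by (intro LIMSEQ_le_const[OF tendsto_inner[OF limu tendsto_const]]) (auto simp: C)
    then have "g \<bullet> \<Gamma> \<beta> \<ge> 1" using g(3) by (simp add: p_def dot_square_norm)
    moreover have "(norm (g - \<Gamma> \<beta>))\<^sup>2 = 2 - 2 * (g \<bullet> \<Gamma> \<beta>)"
      using n[OF g(3)] g(2)
      by (simp add: power2_norm_eq_inner inner_diff_left inner_diff_right inner_commute norm_eq_1)
    ultimately have "(norm (g - \<Gamma> \<beta>))\<^sup>2 \<le> 0" by linarith
    then have gu: "(g, - \<beta>) = u \<beta>" by (simp add: u_def)
    have "u (B k) \<bullet> Z k < 0" for k
      using serves_constraint[OF \<Gamma> B(1)] B(1) by (intro B(2)) (auto simp: u_def[symmetric] C)
    then have "u \<beta> \<bullet> z \<le> 0"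
      by (intro LIMSEQ_le_const2[OF tendsto_inner[OF limu limZ, unfolded gu]]) (auto intro: less_imp_le)
    moreover have "u \<beta> \<bullet> q \<ge> 0" using True \<beta>1(2) sym[of \<beta> \<beta>1] by (simp add: C q_def)
    moreover have "t * (u \<beta> \<bullet> c) > 0" using uc[OF g(3)] t(1) by simp
    ultimately show False by (simp add: z_def inner_add_right)
  next
    case False
    then obtain v where v: "\<And>w. w \<in> C_set \<Gamma> \<Longrightarrow> v \<bullet> w \<ge> 0" "norm (fst v) < - snd v \<bullet> \<beta>"
      using strict_server[OF \<Gamma> g(3)] by (auto simp: p_def)
    \<comment> \<open>A third of the slack: adding \<open>\<epsilon> *\<^sub>R u \<beta>1\<close>
      costs at most \<epsilon> on each side of the serving inequality, so it stays strict and
      survives replacing \<beta> by nearby \<open>B (r k)\<close>.\<close>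
    define \<epsilon> where "\<epsilon> = (- snd v \<bullet> \<beta> - norm (fst v)) / 3"
    have \<epsilon>: "\<epsilon> > 0" using v(2) by (simp add: \<epsilon>_def)
    \<comment> \<open>The first summand may vanish at \<open>z\<close>; the second is positive there since \<open>u \<beta>1 \<bullet> q = 0\<close>.\<close>
    define v' where "v' = v + \<epsilon> *\<^sub>R u \<beta>1"
    have v'C: "v' \<bullet> w \<ge> 0" if "w \<in> C_set \<Gamma>" for w
      using v(1)[OF that] that \<epsilon> \<beta>1(2) by (simp add: v'_def inner_add_left C)
    have "u \<beta>1 \<bullet> q = 0" using \<beta>1(2) n by (simp add: u_def q_def p_def dot_square_norm)
    then have "\<epsilon> * (u \<beta>1 \<bullet> z) > 0" using uc[OF \<beta>1(2)] t(1) \<epsilon> by (simp add: z_def inner_add_right)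
    then have "v' \<bullet> z > 0" using v(1)[OF t(2)] by (simp add: v'_def inner_add_left z_def)
    moreover have "(\<lambda>k. v' \<bullet> Z (r k)) \<longlonglongrightarrow> v' \<bullet> z" by (intro tendsto_intros limZ)
    ultimately have e1: "\<forall>\<^sub>F k in sequentially. v' \<bullet> Z (r k) > 0" by (rule order_tendstoD(1)[rotated])
    have "norm (fst v') \<le> norm (fst v) + \<epsilon>"
      using norm_triangle_ineq[of "fst v" "\<epsilon> *\<^sub>R \<Gamma> \<beta>1"] n[OF \<beta>1(2)] \<epsilon> by (simp add: v'_def u_def)
    moreover have "\<beta>1 \<bullet> \<beta> \<ge> - 1"
      using Cauchy_Schwarz_ineq2[of \<beta>1 \<beta>] \<beta>1(2) g(3) by simp
    then have "- \<epsilon> \<le> \<epsilon> * (\<beta>1 \<bullet> \<beta>)" using mult_left_mono[of "-1" "\<beta>1 \<bullet> \<beta>" \<epsilon>] \<epsilon> by simp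
    then have "- snd v' \<bullet> \<beta> \<ge> - snd v \<bullet> \<beta> - \<epsilon>"
      by (simp add: v'_def u_def inner_diff_left inner_add_left)
    moreover have "3 * \<epsilon> = - snd v \<bullet> \<beta> - norm (fst v)" by (simp add: \<epsilon>_def)
    ultimately have "norm (fst v') < - snd v' \<bullet> \<beta>" using \<epsilon> by linarith
    moreover have "(\<lambda>k. - snd v' \<bullet> B (r k)) \<longlonglongrightarrow> - snd v' \<bullet> \<beta>" by (intro tendsto_intros limB)
    ultimately have e2: "\<forall>\<^sub>F k in sequentially. norm (fst v') < - snd v' \<bullet> B (r k)"
      by (rule order_tendstoD(1)[rotated])
    from eventually_conj[OF e1 e2] obtain k where
      k: "v' \<bullet> Z (r k) > 0" "norm (fst v') < - snd v' \<bullet> B (r k)"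
      by (auto simp: eventually_sequentially)
    then have "serves v' (B (r k))" by (auto simp: serves_def)
    then have "v' \<bullet> Z (r k) < 0" using v'C by (intro B(2)) auto
    with k show False by simp
  qed
qed

theorem theorem2:
  fixes \<Gamma> :: "real ^ 'm \<Rightarrow> real ^ 'n"
  assumes "\<Gamma> \<in> sphere 0 1 \<rightarrow> sphere 0 1"
  shows "(full_dimensional (C_set \<Gamma>) \<and> maximal_S_free Q (C_set \<Gamma>)) \<longleftrightarrow>
         (nonexpansive \<Gamma> \<and> (0, 0) \<notin> convex hull {(\<Gamma> \<beta>, - \<beta>) | \<beta>. \<beta> \<in> sphere 0 1})"
proof
  assume "full_dimensional (C_set \<Gamma>) \<and> maximal_S_free Q (C_set \<Gamma>)"
  then show "nonexpansive \<Gamma> \<and> (0, 0) \<notin> convex hull {(\<Gamma> \<beta>, - \<beta>) | \<beta>. \<beta> \<in> sphere 0 1}"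
    by (intro conjI maximal_imp_nonexpansive[OF assms] zero_notin_hull) simp_all
next
  assume R: "nonexpansive \<Gamma> \<and> (0, 0) \<notin> convex hull {(\<Gamma> \<beta>, - \<beta>) | \<beta>. \<beta> \<in> sphere 0 1}"
  have "full_dimensional (C_set \<Gamma>)"
    by (rule full_dimensional_C_set[OF assms R[THEN conjunct1] R[THEN conjunct2]])
  with maximal_C_set[OF assms R[THEN conjunct1]]
  show "full_dimensional (C_set \<Gamma>) \<and> maximal_S_free Q (C_set \<Gamma>)" by simp
qed

end
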